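(* Let $m\in\mathbb{Z}_{>0}$. Then $S(m)=\{(g_i,\ g_{t-i+1},\ m): i\in\{1,\dots,t\}\}$ is the set of maximal elements of $\Gamma(m)$ (with respect to the componentwise order).
   Context: Let $p$ be a prime, $\mathbb{F}=\mathbb{F}_p$, $S=\mathbb{F}[x,y]$, $\mathrm{Der}_S=S\partial_x\oplus S\partial_y$. Let $\mathcal{A}=\{H_1,H_2,H_3\}$ with $H_1=\ker x$, $H_2=\ker y$, $H_3=\ker(x+y)$, $\alpha_1=x,\alpha_2=y,\alpha_3=x+y$. For $\mu=(\mu_1,\mu_2,\mu_3)\in\mathbb{Z}_{\ge0}^3$, $D(\mathcal{A},\mu)=\{\theta\in\mathrm{Der}_S:\theta(\alpha_i)\in\alpha_i^{\mu_i}S,\ i=1,2,3\}$. Let $\Lambda(m)=\{\mu\in\mathbb{Z}_{\ge0}^3:\mu_3=m\}$, partially ordered componentwise. For $\mu\in\Lambda(m)$ let $\psi_\mu=\sum_{j=\mu_1}^{m}\binom{m}{j}x^jy^{m-j}\partial_x+\sum_{j=0}^{\mu_1-1}\binom{m}{j}x^jy^{m-j}\partial_y$ (binomial coefficients read in $\mathbb{F}_p$; empty sums are zero) and $\psi'_\mu=x^{\mu_1}y^{\mu_2}(\partial_y-\partial_x)$, and $\Gamma(m)=\{\mu\in\Lambda(m):\{\psi_\mu,\psi'_\mu\}\text{ is a basis for }D(\mathcal{A},\mu)\}$. Write the base-$p$ expansion $n=\sum_{e\ge0}c_e(n)p^e$ with $0\le c_e(n)<p$. Let $G_m=\{g\in\mathbb{Z}_{\ge0}:c_e(g)\le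 c_e(m)\text{ for all }e\}=\{g_0,\dots,g_t\}$ with $0=g_0<g_1<\dots<g_t=m$. *)

theory Defs
  imports
    "Berlekamp_Zassenhaus.Finite_Field"
    "HOL-Library.Function_Algebras"
    "HOL-Library.Product_Order"
begin

text \<open>
  The field with \<open>p\<close> elements is the type \<open>'p mod_ring\<close> with \<open>'p :: prime_card\<close> and
  \<open>p = CARD('p)\<close>.  The ring \<open>S\<close> is the iterated polynomial ring: the inner variable is \<open>x\<close>,
  the outer one is \<open>y\<close>.
\<close>

type_synonym 'p S = "'p mod_ring poly poly"

definition varx :: "'p::prime_card S" where
  "varx = [:[:0, 1:]:]"

definition vary :: "'p::prime_card S" where
  "vary = [:0, 1:]"

definition dx :: "'p::prime_card S \<Rightarrow> 'p S" where
  "dx h = map_poly pderiv h"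

definition dy :: "'p::prime_card S \<Rightarrow> 'p S" where
  "dy h = pderiv h"

definition der_scale :: "'p::prime_card S \<Rightarrow> ('p S \<Rightarrow> 'p S) \<Rightarrow> ('p S \<Rightarrow> 'p S)" where
  "der_scale s \<theta> = (\<lambda>h. s * \<theta> h)"

text \<open>
  Derivations are actual maps from \<open>S\<close> to \<open>S\<close>, with pointwise addition (\<open>Function_Algebras\<close>).
  The interpretation provides \<open>der.span\<close> and \<open>der.independent\<close> for this \<open>S\<close>-module.
\<close>

interpretation der: Modules.module der_scale
  by unfold_locales (auto simp: der_scale_def fun_eq_iff algebra_simps)

definition Der :: "('p::prime_card S \<Rightarrow> 'p S) set" where
  "Der = {der_scale f dx + der_scale g dy | f g. True}"

lemma der_apply: "(der_scale f dx + der_scale g dy) h = f * dx h + g * dy h"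
  by (simp add: der_scale_def)

lemma dx_varx [simp]: "dx varx = 1"
  and dy_varx [simp]: "dy varx = 0"
  and dx_vary [simp]: "dx vary = 0"
  and dy_vary [simp]: "dy vary = 1"
  by (simp_all add: dx_def dy_def varx_def vary_def pderiv_pCons map_poly_pCons one_pCons)

lemma dx_add: "dx (a + b) = dx a + dx b"
  by (simp add: dx_def poly_eq_iff coeff_map_poly pderiv_add)

lemma dy_add: "dy (a + b) = dy a + dy b"
  by (simp add: dy_def pderiv_add)

type_synonym multiplicity = "nat \<times> nat \<times> nat"

definition D_A :: "multiplicity \<Rightarrow> ('p::prime_card S \<Rightarrow> 'p S) set" where
  "D_A = (\<lambda>(\<mu>1, \<mu>2, \<mu>3). {\<theta> \<in> Der. varx ^ \<mu>1 dvd \<theta> varx \<and> vary ^ \<mu>2 dvd \<theta> vary \<and>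
     (varx + vary) ^ \<mu>3 dvd \<theta> (varx + vary)})"

definition module_basis :: "('p::prime_card S \<Rightarrow> 'p S) set \<Rightarrow> ('p S \<Rightarrow> 'p S) set \<Rightarrow> bool" where
  "module_basis B M \<longleftrightarrow> der.independent B \<and> der.span B = M"

definition Lambda_set :: "nat \<Rightarrow> multiplicity set" where
  "Lambda_set m = {(\<mu>1, \<mu>2, \<mu>3). \<mu>3 = m}"

text \<open>
  In the second sum \<open>j\<close> may exceed \<open>m\<close> (when \<open>\<mu>1 > m + 1\<close>); the truncated subtraction \<open>m - j\<close>
  is harmless there because the binomial coefficient vanishes.  The index set \<open>{..<\<mu>1}\<close>
  stands for the range from \<open>0\<close> to \<open>\<mu>1 - 1\<close>, which is empty for \<open>\<mu>1 = 0\<close>.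
\<close>

definition psi :: "multiplicity \<Rightarrow> ('p::prime_card S \<Rightarrow> 'p S)" where
  "psi = (\<lambda>(\<mu>1, \<mu>2, m).
     der_scale (\<Sum>j\<in>{\<mu>1..m}. of_nat (m choose j) * varx ^ j * vary ^ (m - j)) dx
     + der_scale (\<Sum>j\<in>{..<\<mu>1}. of_nat (m choose j) * varx ^ j * vary ^ (m - j)) dy)"

definition psi' :: "multiplicity \<Rightarrow> ('p::prime_card S \<Rightarrow> 'p S)" where
  "psi' = (\<lambda>(\<mu>1, \<mu>2, m). der_scale (varx ^ \<mu>1 * vary ^ \<mu>2) (dy - dx))"

definition Gamma_set :: "'p::prime_card itself \<Rightarrow> nat \<Rightarrow> multiplicity set" where
  "Gamma_set _ m = {\<mu> \<in> Lambda_set m. module_basis {psi \<mu> :: 'p S \<Rightarrow> 'p S, psi' \<mu>} (D_A \<mu>)}"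

text \<open>The order on triples is the componentwise one from \<open>Product_Order\<close>.\<close>

definition maximal_elements :: "'a::order set \<Rightarrow> 'a set" where
  "maximal_elements A = {a \<in> A. \<forall>b\<in>A. a \<le> b \<longrightarrow> b = a}"

definition digit :: "nat \<Rightarrow> nat \<Rightarrow> nat \<Rightarrow> nat" where
  "digit p e n = n div p ^ e mod p"

definition G_set :: "nat \<Rightarrow> nat \<Rightarrow> nat set" where
  "G_set p m = {g. \<forall>e. digit p e g \<le> digit p e m}"

text \<open>
  \<open>G_set p m\<close> is a finite set with least element \<open>0\<close> and greatest element \<open>m\<close>; hence it has a unique
  increasing enumeration, which starts with \<open>0\<close> and ends with \<open>m\<close>.
\<close>

lemma zero_in_G: "0 \<in> G_set p m"
  by (simp add: G_set_def digit_def)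

lemma self_in_G: "m \<in> G_set p m"
  by (simp add: G_set_def)

lemma le_if_digits_le:
  assumes "p \<ge> 2" and "\<And>e. digit p e g \<le> digit p e m"
  shows "g \<le> m"
  using assms(2)
proof (induction g arbitrary: m rule: less_induct)
  case (less g)
  show ?case
  proof (cases "g = 0")
    case False
    have "g div p \<le> m div p"
    proof (rule less.IH)
      show "g div p < g" using False assms(1) by simp
      show "digit p e (g div p) \<le> digit p e (m div p)" for e
        using less.prems[of "Suc e"] by (simp add: digit_def div_mult2_eq)
    qed
    moreover have "g mod p \<le> m mod p"
      using less.prems[of 0] by (simp add: digit_def)
    ultimately have "p * (g div p) + g mod p \<le> p * (m div p) + m mod p"
      by (intro add_mono mult_le_mono2)
    then show ?thesis by simp
  qed simp
qed

lemma finite_G: "p \<ge> 2 \<Longrightarrow> finite (G_set p m)"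
  by (rule finite_subset[of _ "{..m}"]) (auto simp: G_set_def intro: le_if_digits_le)

end

(*
  A derivation theta in D(A, mu) satisfies theta(x + y) = h (x + y)^m, and since psi_mu(x + y) =
  (x + y)^m, the difference theta - h psi_mu kills x + y; once psi_mu itself lies in D(A, mu), this
  difference is a multiple of psi'_mu.  Hence mu is in Gamma(m) iff y^mu_2 divides psi_mu(y), that
  is, iff j + mu_2 <= m for every j < mu_1 with binomial(m, j) nonzero modulo p.  By Lucas' theorem
  these j are the elements of G_m below mu_1.  Since G_m is stable under g -> m - g, its enumeration
  satisfies g_(t-k) = m - g_k, and the maximal elements can be read off.
*)
theory Submission
  imports Defs
begin

section \<open>Binomial coefficients modulo a prime\<close>

lemma CHAR_mod_ring: "CHAR('p::prime_card mod_ring) = CARD('p)"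
  by (rule CHAR_eqI) (auto intro: of_nat_0_mod_ring_dvd)

lemma of_nat_mod_ring_eq_0_iff:
  "(of_nat n :: 'p::prime_card mod_ring) = 0 \<longleftrightarrow> CARD('p) dvd n"
  by (simp add: of_nat_eq_0_iff_char_dvd CHAR_mod_ring)

lemma one_plus_X_power_CARD:
  "[:1, 1 :: 'p::prime_card mod_ring:] ^ CARD('p) = monom 1 CARD('p) + 1"
proof -
  have "CHAR('p mod_ring poly) = CARD('p)" by (simp add: CHAR_mod_ring)
  then have "(monom 1 1 + 1 :: 'p mod_ring poly) ^ CARD('p) = monom 1 1 ^ CARD('p) + 1 ^ CARD('p)"
    using freshmans_dream[where x = "monom 1 1 :: 'p mod_ring poly" and y = 1]
      prime_card[where 'a='p]
    by simp
  moreover have "(monom 1 1 + 1 :: 'p mod_ring poly) = [:1, 1:]"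
    by (simp add: monom_altdef one_pCons)
  ultimately show ?thesis by (simp add: monom_power)
qed

lemma monom_plus_1_power:
  "(monom 1 n + 1 :: 'a::comm_ring_1 poly) ^ a = (\<Sum>k\<le>a. monom (of_nat (a choose k)) (n * k))"
  unfolding binomial_ring by (rule sum.cong) (simp_all add: monom_power of_nat_poly smult_monom)

text \<open>One digit of Lucas' theorem: compare coefficients in
  \<open>(1+X)^(pa+b) = (1+X^p)^a (1+X)^b\<close>, a consequence of the Frobenius identity. As
  \<open>b\<close> and \<open>d\<close> are below \<open>p\<close>, only the term with
  \<open>k = c\<close> contributes.\<close>

lemma lucas_step:
  fixes a b c d :: nat
  assumes "b < CARD('p::prime_card)" "d < CARD('p)"
  shows "(of_nat ((CARD('p) * a + b) choose (CARD('p) * c + d)) :: 'p mod_ring)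
    = of_nat (a choose c) * of_nat (b choose d)"
proof -
  let ?p = "CARD('p)"
  let ?L = "[:1, 1 :: 'p mod_ring:]"
  have coeff_L: "coeff (?L ^ n) i = of_nat (n choose i)" for n i
  proof (cases "i \<le> n")
    case False
    have "degree (?L ^ n) \<le> n" using degree_power_le[of ?L n] by simp
    with False show ?thesis by (simp add: coeff_eq_0 binomial_eq_0)
  qed (simp add: coeff_linear_poly_power)
  have expand: "?L ^ (?p * a + b) = (\<Sum>k\<le>a. monom (of_nat (a choose k)) (?p * k)) * ?L ^ b"
    by (simp only: power_add power_mult one_plus_X_power_CARD monom_plus_1_power)
  have "(of_nat ((?p * a + b) choose (?p * c + d)) :: 'p mod_ring)
      = coeff (?L ^ (?p * a + b)) (?p * c + d)"
    by (simp only: coeff_L)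
  also have "\<dots> = (\<Sum>k\<le>a. coeff (monom (of_nat (a choose k)) (?p * k) * ?L ^ b) (?p * c + d))"
    by (simp only: expand sum_distrib_right coeff_sum)
  also have "\<dots> = (\<Sum>k\<le>a. if k = c then of_nat (a choose c) * of_nat (b choose d) else 0)"
  proof (rule sum.cong)
    fix k
    consider "k = c" | "k < c" | "c < k" by linarith
    then show "coeff (monom (of_nat (a choose k)) (?p * k) * ?L ^ b) (?p * c + d)
        = (if k = c then of_nat (a choose c) * of_nat (b choose d) else 0)"
    proof cases
      case 1
      then show ?thesis by (simp add: coeff_monom_mult coeff_L)
    next
      case 2
      \<comment> \<open>The exponent left for the second factor is at least \<open>p\<close>, hence
        beyond its degree \<open>b\<close>.\<close>
      then have "?p * Suc k \<le> ?p * c" by (intro mult_le_mono2) simp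
      then have "b < ?p * c + d - ?p * k" using assms(1) by simp
      with 2 show ?thesis by (simp add: coeff_monom_mult coeff_L binomial_eq_0)
    next
      case 3
      then have "?p * Suc c \<le> ?p * k" by (intro mult_le_mono2) simp
      then have "?p * c + d < ?p * k" using assms(2) by simp
      with 3 show ?thesis by (simp add: coeff_monom_mult)
    qed
  qed simp
  \<comment> \<open>If \<open>c > a\<close>, the index \<open>c\<close> is missing from the sum, but
    then \<open>a choose c\<close> vanishes too.\<close>
  also have "\<dots> = of_nat (a choose c) * of_nat (b choose d)"
    by (auto simp: sum.delta binomial_eq_0)
  finally show ?thesis .
qed

text \<open>For \<open>d \<le> b\<close> the coefficient divides \<open>fact b\<close>, all of whose
  factors are smaller than \<open>p\<close>.\<close>

lemma binomial_below_prime: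
  fixes p :: nat
  assumes "prime p" "b < p"
  shows "p dvd (b choose d) \<longleftrightarrow> b < d"
proof
  assume dvd: "p dvd (b choose d)"
  show "b < d"
  proof (rule ccontr)
    assume "\<not> b < d"
    then have "(b choose d) dvd fact b"
      by (metis binomial_fact_lemma dvd_triv_right not_less)
    with dvd assms show False by (meson dvd_trans prime_dvd_fact_iff leD)
  qed
qed (simp add: binomial_eq_0)

lemma mem_G_set_iff_div_mod:
  "j \<in> G_set p m \<longleftrightarrow> j mod p \<le> m mod p \<and> j div p \<in> G_set p (m div p)"
proof -
  have "(\<forall>e. digit p e j \<le> digit p e m) \<longleftrightarrow>
      digit p 0 j \<le> digit p 0 m \<and> (\<forall>e. digit p (Suc e) j \<le> digit p (Suc e) m)"
    by (metis not0_implies_Suc)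
  then show ?thesis by (simp add: G_set_def digit_def div_mult2_eq)
qed

text \<open>Lucas' theorem, by induction on \<open>j\<close>: removing the last digit splits off one
  binomial factor, which vanishes iff that digit of \<open>j\<close> exceeds the one of
  \<open>m\<close>; a product in a field vanishes iff a factor does.\<close>

theorem mem_G_set_iff_binomial:
  "j \<in> G_set CARD('p::prime_card) m \<longleftrightarrow> (of_nat (m choose j) :: 'p mod_ring) \<noteq> 0"
proof (induction j arbitrary: m rule: less_induct)
  case (less j)
  let ?p = "CARD('p)"
  have p: "prime ?p" by (rule prime_card)
  then have p2: "?p \<ge> 2" by (rule prime_ge_2_nat)
  show ?case
  proof (cases "j = 0")
    case True
    then show ?thesis by (simp add: zero_in_G)
  next
    case False
    with p2 have IH: "j div ?p \<in> G_set ?p (m div ?p) \<longleftrightarrow>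
        (of_nat ((m div ?p) choose (j div ?p)) :: 'p mod_ring) \<noteq> 0"
      by (intro less.IH) simp
    have "(of_nat (m choose j) :: 'p mod_ring) =
        of_nat ((m div ?p) choose (j div ?p)) * of_nat ((m mod ?p) choose (j mod ?p))"
      using lucas_step[of "m mod ?p" "j mod ?p" "m div ?p" "j div ?p", where 'p='p] p2 by simp
    moreover have "(of_nat ((m mod ?p) choose (j mod ?p)) :: 'p mod_ring) = 0 \<longleftrightarrow>
        m mod ?p < j mod ?p"
      unfolding of_nat_mod_ring_eq_0_iff using p p2 by (intro binomial_below_prime) auto
    ultimately show ?thesis by (auto simp: mem_G_set_iff_div_mod[of j] IH)
  qed
qed

lemma G_set_le:
  assumes "j \<in> G_set CARD('p::prime_card) m"
  shows "j \<le> m"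
  using assms by (rule_tac ccontr) (simp add: mem_G_set_iff_binomial binomial_eq_0)

text \<open>Digitwise this is subtraction without borrowing; the symmetry of binomial coefficients
  gives it at once.\<close>

lemma G_set_diff:
  assumes "j \<in> G_set CARD('p::prime_card) m"
  shows "m - j \<in> G_set CARD('p) m"
  using assms G_set_le[OF assms] by (simp add: mem_G_set_iff_binomial flip: binomial_symmetric)

section \<open>The multiplicities for which the two derivations form a basis\<close>

lemma varx_power: "varx ^ n = [:monom 1 n:]"
  by (simp add: varx_def poly_const_pow monom_altdef)

lemma vary_power: "vary ^ n = monom 1 n"
  by (simp add: vary_def monom_altdef)

lemma varx_plus_vary_nonzero: "(varx + vary :: 'p::prime_card S) \<noteq> 0"
  by (simp add: varx_def vary_def)

text \<open>Dividing by \<open>vary ^ b\<close> only shifts the coefficients in y, while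
  divisibility by \<open>varx ^ a\<close> is tested on each coefficient separately, so it passes to
  the quotient.\<close>

lemma varx_vary_power_dvd:
  fixes f :: "'p::prime_card S"
  assumes "varx ^ a dvd f" "vary ^ b dvd f"
  shows "varx ^ a * vary ^ b dvd f"
proof -
  from assms(2) obtain q where f: "f = monom 1 b * q" by (auto simp: vary_power)
  have "monom 1 a dvd coeff q n" for n
  proof -
    have "monom 1 a dvd coeff f (n + b)"
      using assms(1) by (simp add: varx_power const_poly_dvd_iff)
    then show ?thesis by (simp add: f coeff_monom_mult)
  qed
  then have "varx ^ a dvd q" by (simp add: varx_power const_poly_dvd_iff)
  then show ?thesis by (auto simp: f vary_power mult.commute intro: mult_dvd_mono)
qed

section \<open>The coefficients of psi\<close>

definition psi_x :: "nat \<Rightarrow> nat \<Rightarrow> 'p::prime_card S" where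
  "psi_x a m = (\<Sum>j\<in>{a..m}. of_nat (m choose j) * varx ^ j * vary ^ (m - j))"

definition psi_y :: "nat \<Rightarrow> nat \<Rightarrow> 'p::prime_card S" where
  "psi_y a m = (\<Sum>j\<in>{..<a}. of_nat (m choose j) * varx ^ j * vary ^ (m - j))"

lemma psi_apply: "psi (a, b, m) h = psi_x a m * dx h + psi_y a m * dy h"
  by (simp add: psi_def psi_x_def psi_y_def der_scale_def)

lemma psi'_apply: "psi' (a, b, m) h = varx ^ a * vary ^ b * (dy h - dx h)"
  by (simp add: psi'_def der_scale_def)

lemma psi_x_plus_psi_y: "psi_x a m + psi_y a m = (varx + vary :: 'p::prime_card S) ^ m"
proof -
  let ?f = "\<lambda>j. of_nat (m choose j) * varx ^ j * vary ^ (m - j) :: 'p S"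
  have "psi_x a m + psi_y a m = sum ?f ({a..m} \<union> {..<a})"
    unfolding psi_x_def psi_y_def by (rule sum.union_disjoint[symmetric]) auto
  \<comment> \<open>For \<open>a > m + 1\<close> the union reaches past \<open>m\<close>, where the
    binomial coefficients are zero.\<close>
  also have "\<dots> = sum ?f {..m}"
    by (rule sum.mono_neutral_right) (auto simp: binomial_eq_0)
  also have "\<dots> = (varx + vary) ^ m"
    by (simp add: binomial_ring)
  finally show ?thesis .
qed

lemma varx_power_dvd_psi_x: "varx ^ a dvd (psi_x a m :: 'p::prime_card S)"
  unfolding psi_x_def
  by (intro dvd_sum dvd_mult2 dvd_mult le_imp_power_dvd) simp

text \<open>The nonzero terms carry pairwise distinct powers of y, so nothing cancels and
  divisibility can be tested term by term.\<close>

lemma vary_power_dvd_psi_y_iff: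
  "vary ^ b dvd (psi_y a m :: 'p::prime_card S) \<longleftrightarrow>
    (\<forall>j\<in>G_set CARD('p) m. j < a \<longrightarrow> j + b \<le> m)"
proof
  let ?f = "\<lambda>j. of_nat (m choose j) * varx ^ j * vary ^ (m - j) :: 'p S"
  have f: "?f j = monom (monom (of_nat (m choose j)) j) (m - j)" for j
    by (simp add: varx_power vary_power of_nat_poly mult_monom smult_monom flip: monom_0)
  assume dvd: "vary ^ b dvd (psi_y a m :: 'p S)"
  show "\<forall>j\<in>G_set CARD('p) m. j < a \<longrightarrow> j + b \<le> m"
  proof (intro ballI impI, rule ccontr)
    fix j assume j: "j \<in> G_set CARD('p) m" "j < a" "\<not> j + b \<le> m"
    from j(1) have jm: "j \<le> m" by (rule G_set_le)
    have "coeff (psi_y a m :: 'p S) (m - j) = (\<Sum>i<a. coeff (?f i) (m - j))"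
      by (simp add: psi_y_def coeff_sum)
    also have "\<dots> = (\<Sum>i<a. if i = j then monom (of_nat (m choose j)) j else 0)"
    proof (rule sum.cong)
      fix i
      show "coeff (?f i) (m - j) = (if i = j then monom (of_nat (m choose j)) j else 0)"
        \<comment> \<open>For \<open>i > m\<close> the truncated exponent \<open>m - i\<close> is 0
          and collides with \<open>m - j\<close> when \<open>j = m\<close>; the zero binomial
          coefficient removes such terms.\<close>
        using jm by (cases "i \<le> m") (auto simp: f binomial_eq_0)
    qed simp
    also have "\<dots> = monom (of_nat (m choose j)) j"
      using j(2) by simp
    also have "\<dots> \<noteq> 0"
      using j(1) by (simp add: mem_G_set_iff_binomial)
    finally have "coeff (psi_y a m :: 'p S) (m - j) \<noteq> 0" .
    moreover have "m - j < b" using j(3) jm by simp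
    ultimately show False
      using dvd by (simp add: vary_power monom_1_dvd_iff')
  qed
next
  assume *: "\<forall>j\<in>G_set CARD('p) m. j < a \<longrightarrow> j + b \<le> m"
  show "vary ^ b dvd (psi_y a m :: 'p S)"
    unfolding psi_y_def
  proof (rule dvd_sum)
    fix j assume j: "j \<in> {..<a}"
    show "vary ^ b dvd (of_nat (m choose j) * varx ^ j * vary ^ (m - j) :: 'p S)"
    proof (cases "j \<in> G_set CARD('p) m")
      case True
      with * j have "b \<le> m - j" by fastforce
      then show ?thesis by (intro dvd_mult le_imp_power_dvd)
    next
      case False
      then show ?thesis by (simp add: mem_G_set_iff_binomial of_nat_poly)
    qed
  qed
qed

text \<open>The conditions at x and x+y always hold: each term of \<open>psi_x\<close> contains
  \<open>varx ^ a\<close>, and the value at x+y is exactly the m-th power. Only the condition at y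
  remains.\<close>

lemma psi_mem_D_A_iff:
  "(psi (a, b, m) :: 'p::prime_card S \<Rightarrow> 'p S) \<in> D_A (a, b, m) \<longleftrightarrow> vary ^ b dvd (psi_y a m :: 'p S)"
proof -
  have "psi (a, b, m) \<in> (Der :: ('p S \<Rightarrow> 'p S) set)"
    unfolding Der_def psi_def by auto
  then show ?thesis
    by (simp add: D_A_def psi_apply dx_add dy_add psi_x_plus_psi_y varx_power_dvd_psi_x)
qed

lemma psi'_mem_D_A: "(psi' (a, b, m) :: 'p::prime_card S \<Rightarrow> 'p S) \<in> D_A (a, b, m)"
proof -
  have "psi' (a, b, m) =
      der_scale (- (varx ^ a * vary ^ b)) dx + der_scale (varx ^ a * vary ^ b :: 'p S) dy"
    by (simp add: fun_eq_iff psi'_apply der_scale_def algebra_simps)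
  then have "psi' (a, b, m) \<in> (Der :: ('p S \<Rightarrow> 'p S) set)"
    unfolding Der_def by blast
  then show ?thesis
    by (simp add: D_A_def psi'_apply dx_add dy_add)
qed

lemma subspace_D_A: "der.subspace (D_A (a, b, m) :: ('p::prime_card S \<Rightarrow> 'p S) set)"
proof (rule der.subspaceI)
  have "(0 :: 'p S \<Rightarrow> 'p S) = der_scale 0 dx + der_scale 0 dy"
    by (simp add: der_scale_def fun_eq_iff)
  then have "(0 :: 'p S \<Rightarrow> 'p S) \<in> Der" unfolding Der_def by blast
  then show "(0 :: 'p S \<Rightarrow> 'p S) \<in> D_A (a, b, m)" by (simp add: D_A_def)
next
  fix u v :: "'p S \<Rightarrow> 'p S"
  assume uv: "u \<in> D_A (a, b, m)" "v \<in> D_A (a, b, m)"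
  then obtain f g f' g' where "u = der_scale f dx + der_scale g dy"
    "v = der_scale f' dx + der_scale g' dy" by (auto simp: D_A_def Der_def)
  then have "u + v = der_scale (f + f') dx + der_scale (g + g') dy"
    by (simp add: algebra_simps)
  then have "u + v \<in> Der" unfolding Der_def by blast
  with uv show "u + v \<in> D_A (a, b, m)" by (simp add: D_A_def)
next
  fix c :: "'p S" and u :: "'p S \<Rightarrow> 'p S"
  assume u: "u \<in> D_A (a, b, m)"
  then obtain f g where "u = der_scale f dx + der_scale g dy" by (auto simp: D_A_def Der_def)
  then have "der_scale c u = der_scale (c * f) dx + der_scale (c * g) dy"
    by (simp add: der.scale_right_distrib)
  then have "der_scale c u \<in> Der" unfolding Der_def by blast
  with u show "der_scale c u \<in> D_A (a, b, m)" by (simp add: D_A_def der_scale_def)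
qed

section \<open>Independence and generation\<close>

lemma psi_neq_psi': "(psi (a, b, m) :: 'p::prime_card S \<Rightarrow> 'p S) \<noteq> psi' (a, b, m)"
proof
  assume "(psi (a, b, m) :: 'p S \<Rightarrow> 'p S) = psi' (a, b, m)"
  then have "(psi (a, b, m) :: 'p S \<Rightarrow> 'p S) (varx + vary) = psi' (a, b, m) (varx + vary)"
    by simp
  then show False
    by (simp add: psi_apply psi'_apply dx_add dy_add psi_x_plus_psi_y varx_plus_vary_nonzero)
qed

text \<open>Evaluation at x+y kills \<open>psi'\<close> and forces \<open>c = 0\<close>; evaluation
  at y then forces \<open>d = 0\<close>.\<close>

lemma independent_psi_psi':
  "der.independent {psi (a, b, m) :: 'p::prime_card S \<Rightarrow> 'p S, psi' (a, b, m)}"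
proof -
  have "c = 0 \<and> d = 0"
    if "der_scale c (psi (a, b, m)) + der_scale d (psi' (a, b, m)) = (0 :: 'p S \<Rightarrow> 'p S)" for c d
  proof -
    have eq: "c * psi (a, b, m) h + d * psi' (a, b, m) h = 0" for h
      using fun_cong[OF that, of h] by (simp add: der_scale_def)
    have "c = 0"
      using eq[of "varx + vary"]
      by (simp add: psi_apply psi'_apply dx_add dy_add psi_x_plus_psi_y varx_plus_vary_nonzero)
    with eq[of vary] show ?thesis
      by (simp add: psi'_apply) (simp add: varx_def vary_def)
  qed
  \<comment> \<open>A linear relation is a sum over the set; it has two separate terms because the
    two derivations differ.\<close>
  then show ?thesis
    using psi_neq_psi'[of a b m, where 'p='p] by (fastforce simp: der.dependent_finite)
qed

lemma D_A_subset_span: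
  assumes "(psi (a, b, m) :: 'p::prime_card S \<Rightarrow> 'p S) \<in> D_A (a, b, m)"
  shows "D_A (a, b, m) \<subseteq> der.span {psi (a, b, m) :: 'p S \<Rightarrow> 'p S, psi' (a, b, m)}"
proof
  fix \<theta> :: "'p S \<Rightarrow> 'p S"
  assume \<theta>: "\<theta> \<in> D_A (a, b, m)"
  then obtain h where h: "\<theta> (varx + vary) = (varx + vary) ^ m * h"
    by (auto simp: D_A_def dvd_def)
  define \<eta> where "\<eta> = \<theta> - der_scale h (psi (a, b, m))"
  \<comment> \<open>Here the hypothesis on \<open>psi\<close> enters: subtracting its multiple stays
    inside the module.\<close>
  have \<eta>: "\<eta> \<in> D_A (a, b, m)"
    unfolding \<eta>_def using \<theta> assms
    by (intro der.subspace_diff der.subspace_scale subspace_D_A)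
  then obtain f g where fg: "\<eta> = der_scale f dx + der_scale g dy"
    by (auto simp: D_A_def Der_def)
  have "\<eta> (varx + vary) = 0"
    by (simp add: \<eta>_def h der_scale_def psi_apply dx_add dy_add psi_x_plus_psi_y)
  then have "f + g = 0" by (simp add: fg der_scale_def dx_add dy_add)
  then have f: "f = - g" by (simp add: eq_neg_iff_add_eq_0)
  \<comment> \<open>The values at x and y are \<open>- g\<close> and \<open>g\<close>, so both
    remaining conditions fall on \<open>g\<close>.\<close>
  from \<eta> have "varx ^ a dvd g" "vary ^ b dvd g"
    by (simp_all add: D_A_def fg der_scale_def f)
  then obtain q where "g = varx ^ a * vary ^ b * q"
    using varx_vary_power_dvd by blast
  then have "\<eta> = der_scale q (psi' (a, b, m))"
    by (simp add: fg f fun_eq_iff der_scale_def psi'_apply algebra_simps)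
  then have "\<theta> = der_scale h (psi (a, b, m)) + der_scale q (psi' (a, b, m))"
    by (simp add: \<eta>_def algebra_simps)
  then show "\<theta> \<in> der.span {psi (a, b, m), psi' (a, b, m)}"
    by (simp add: der.span_add der.span_scale der.span_base)
qed

lemma module_basis_psi_psi'_iff:
  "module_basis {psi (a, b, m) :: 'p::prime_card S \<Rightarrow> 'p S, psi' (a, b, m)} (D_A (a, b, m)) \<longleftrightarrow>
    (psi (a, b, m) :: 'p S \<Rightarrow> 'p S) \<in> D_A (a, b, m)"
proof
  assume "module_basis {psi (a, b, m) :: 'p S \<Rightarrow> 'p S, psi' (a, b, m)} (D_A (a, b, m))"
  then show "(psi (a, b, m) :: 'p S \<Rightarrow> 'p S) \<in> D_A (a, b, m)"
    by (metis module_basis_def der.span_base insertI1)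
next
  assume *: "(psi (a, b, m) :: 'p S \<Rightarrow> 'p S) \<in> D_A (a, b, m)"
  then have "der.span {psi (a, b, m) :: 'p S \<Rightarrow> 'p S, psi' (a, b, m)} \<subseteq> D_A (a, b, m)"
    by (intro der.span_minimal subspace_D_A) (auto intro: psi'_mem_D_A)
  with D_A_subset_span[OF *] independent_psi_psi'
  show "module_basis {psi (a, b, m) :: 'p S \<Rightarrow> 'p S, psi' (a, b, m)} (D_A (a, b, m))"
    by (auto simp: module_basis_def)
qed

text \<open>All the algebra is condensed here; what follows is combinatorics of a finite set of
  numbers.\<close>

lemma mem_Gamma_set_iff:
  "(a, b, n) \<in> Gamma_set TYPE('p::prime_card) m \<longleftrightarrow>
    n = m \<and> (\<forall>j\<in>G_set CARD('p) m. j < a \<longrightarrow> j + b \<le> m)"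
  by (auto simp: Gamma_set_def Lambda_set_def module_basis_psi_psi'_iff psi_mem_D_A_iff
      vary_power_dvd_psi_y_iff)

section \<open>Maximal elements\<close>

text \<open>The list of values is sorted and distinct, and such a list is determined by its set of
  elements.\<close>

lemma strict_mono_on_enumeration_unique:
  fixes f g :: "nat \<Rightarrow> 'a::linorder"
  assumes "strict_mono_on {0..t} f" "strict_mono_on {0..t} g" "f ` {0..t} = g ` {0..t}" "k \<le> t"
  shows "f k = g k"
proof -
  have *: "sorted (map h [0..<Suc t]) \<and> distinct (map h [0..<Suc t])"
    if "strict_mono_on {0..t} h" for h :: "nat \<Rightarrow> 'a"
  proof
    show "sorted (map h [0..<Suc t])"
      using that
      by (auto simp: sorted_iff_nth_mono_less strict_mono_on_def less_imp_le simp del: upt_Suc)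
    show "distinct (map h [0..<Suc t])"
      using strict_mono_on_imp_inj_on[OF that]
      by (simp add: distinct_map atLeast0LessThan lessThan_Suc_atMost atLeast0AtMost del: upt_Suc)
  qed
  have "map f [0..<Suc t] = map g [0..<Suc t]"
    by (rule sorted_distinct_set_unique)
      (use * assms in \<open>auto simp: atLeastLessThanSuc_atLeastAtMost simp del: upt_Suc\<close>)
  with assms(4) show ?thesis by (simp del: upt_Suc)
qed

text \<open>Reversing the index and reflecting the values by \<open>x \<mapsto> m - x\<close> gives
  another increasing enumeration of the same set, which must be \<open>g\<close> itself.\<close>

lemma G_set_enumeration_symmetric:
  fixes g :: "nat \<Rightarrow> nat"
  assumes mono: "strict_mono_on {0..t} g"
    and G: "G_set CARD('p::prime_card) m = g ` {0..t}"
    and "k \<le> t"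
  shows "g (t - k) = m - g k"
proof -
  have le: "g i \<le> m" if "i \<le> t" for i
    using that by (intro G_set_le[where 'p='p]) (simp add: G)
  \<comment> \<open>Uniqueness is applied at index \<open>t - k\<close>, where the reflected
    enumeration takes the value \<open>m - g k\<close>.\<close>
  have "m - g (t - (t - k)) = g (t - k)"
  proof (rule strict_mono_on_enumeration_unique[of t "\<lambda>i. m - g (t - i)"])
    show "strict_mono_on {0..t} (\<lambda>i. m - g (t - i))"
    proof (rule strict_mono_onI)
      fix r s assume rs: "r \<in> {0..t}" "s \<in> {0..t}" "r < s"
      then have "g (t - s) < g (t - r)" by (intro strict_mono_onD[OF mono]) auto
      with le[of "t - r"] show "m - g (t - r) < m - g (t - s)" by simp
    qed
    have reflect: "(\<lambda>i. t - i) ` {0..t} = {0..t}"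
      by (auto simp: image_iff) (metis atLeastAtMost_iff diff_diff_cancel diff_le_self le0)
    have "(\<lambda>i. m - g (t - i)) ` {0..t} = (\<lambda>x. m - x) ` g ` (\<lambda>i. t - i) ` {0..t}"
      by (simp add: image_image)
    also have "\<dots> = (\<lambda>x. m - x) ` G_set CARD('p) m"
      by (simp only: reflect G)
    also have "\<dots> = G_set CARD('p) m"
    proof (intro equalityI subsetI)
      fix x assume "x \<in> G_set CARD('p) m"
      then show "x \<in> (\<lambda>x. m - x) ` G_set CARD('p) m"
        by (intro image_eqI[of _ _ "m - x"]) (auto dest: G_set_le intro: G_set_diff)
    qed (auto intro: G_set_diff)
    finally show "(\<lambda>i. m - g (t - i)) ` {0..t} = g ` {0..t}"
      by (simp only: G)
  qed (use mono in auto)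
  with \<open>k \<le> t\<close> show ?thesis by simp
qed

theorem theorem5p10:
  fixes m t :: nat and g :: "nat \<Rightarrow> nat"
  assumes "m > 0"
    and "strict_mono_on {0..t} g"
    and "G_set CARD('p::prime_card) m = g ` {0..t}"
  shows "{(g i, g (t - i + 1), m) | i. i \<in> {1..t}} = maximal_elements (Gamma_set TYPE('p) m)"
proof -
  note mono = assms(2) and G = assms(3)
  let ?\<Gamma> = "Gamma_set TYPE('p) m"
  have g_less_iff: "g i < g k \<longleftrightarrow> i < k" if "i \<le> t" "k \<le> t" for i k
    using that strict_mono_on_less[OF mono] by simp
  have g_le: "g i \<le> m" if "i \<le> t" for i
    using that by (intro G_set_le[where 'p='p]) (simp add: G)
  \<comment> \<open>For \<open>g (i - 1) < a \<le> g i\<close> the condition on \<open>b\<close> is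
    constantly \<open>b \<le> m - g (i - 1)\<close>. The set is a staircase with corners
    \<open>(g i, m - g (i - 1), m)\<close>.\<close>
  have Gamma_iff: "(a, b, n) \<in> ?\<Gamma> \<longleftrightarrow> n = m \<and> (\<forall>k\<le>t. g k < a \<longrightarrow> g k + b \<le> m)" for a b n
    by (auto simp: mem_Gamma_set_iff G)
  have sym: "g (t - i + 1) = m - g (i - 1)" if "i \<in> {1..t}" for i
  proof -
    have "t - i + 1 = t - (i - 1)" using that by auto
    then show ?thesis using that G_set_enumeration_symmetric[OF mono G, of "i - 1"] by simp
  qed
  show ?thesis
  proof (intro equalityI subsetI)
    fix \<mu> assume "\<mu> \<in> {(g i, g (t - i + 1), m) | i. i \<in> {1..t}}"
    then obtain i where i: "i \<in> {1..t}" and \<mu>: "\<mu> = (g i, m - g (i - 1), m)"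
      using sym by auto
    have "g k + (m - g (i - 1)) \<le> m" if "k \<le> t" "g k < g i" for k
    proof -
      from that i have "k \<le> i - 1" by (simp add: g_less_iff)
      with i have "g k \<le> g (i - 1)"
        by (metis atLeastAtMost_iff diff_le_self g_less_iff le_trans not_less)
      moreover have "g (i - 1) \<le> m" using i by (intro g_le) auto
      ultimately show ?thesis by simp
    qed
    then have mem: "\<mu> \<in> ?\<Gamma>" by (simp add: \<mu> Gamma_iff)
    have "\<nu> = \<mu>" if \<nu>: "\<nu> \<in> ?\<Gamma>" "\<mu> \<le> \<nu>" for \<nu>
    proof -
      obtain a b where ab: "\<nu> = (a, b, m)" "g i \<le> a" "m - g (i - 1) \<le> b"
        using \<nu> by (cases \<nu>) (auto simp: \<mu> Gamma_iff)
      have bound: "g k + b \<le> m" if "k \<le> t" "g k < a" for k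
        using \<nu>(1) that by (simp add: ab Gamma_iff)
      have less: "g (i - 1) < g i" using i by (subst g_less_iff) auto
      \<comment> \<open>If \<open>a > g i\<close>, the constraint for \<open>k = i\<close> would
        read \<open>g i + b \<le> m\<close>, against
        \<open>b \<ge> m - g (i - 1) > m - g i\<close>.\<close>
      have "a = g i"
        using bound[of i] ab less g_le[of "i - 1"] i by fastforce
      moreover have "b = m - g (i - 1)"
        using bound[of "i - 1"] ab less i by fastforce
      ultimately show ?thesis by (simp add: ab \<mu>)
    qed
    with mem show "\<mu> \<in> maximal_elements ?\<Gamma>" by (auto simp: maximal_elements_def)
  next
    fix \<mu> assume max: "\<mu> \<in> maximal_elements ?\<Gamma>"
    then obtain a b where \<mu>: "\<mu> = (a, b, m)"
      by (cases \<mu>) (auto simp: maximal_elements_def Gamma_iff)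
    have bound: "g k + b \<le> m" if "k \<le> t" "g k < a" for k
      using max that by (simp add: \<mu> maximal_elements_def Gamma_iff)
    have maximal: "a' = a \<and> b' = b" if "(a', b', m) \<in> ?\<Gamma>" "a \<le> a'" "b \<le> b'" for a' b'
      using max that by (auto simp: \<mu> maximal_elements_def)
    obtain k\<^sub>0 where k0: "k\<^sub>0 \<le> t" "g k\<^sub>0 = 0"
      using zero_in_G[of "CARD('p)" m] by (auto simp: G)
    obtain k\<^sub>1 where k1: "k\<^sub>1 \<le> t" "g k\<^sub>1 = m"
      using self_in_G[of m "CARD('p)"] by (auto simp: G)
    \<comment> \<open>With \<open>a = 0\<close> there is no constraint on \<open>b\<close>, which
      could then be raised.\<close>
    have "a \<noteq> 0"
      using maximal[of 0 "Suc b"] by (auto simp: Gamma_iff)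
    have "a \<le> m"
    proof (rule ccontr)
      assume "\<not> a \<le> m"
      \<comment> \<open>Once \<open>a\<close> exceeds \<open>m\<close>, the constraint from the
        value \<open>m\<close> forces \<open>b = 0\<close>, and then \<open>a\<close> can be raised
        freely.\<close>
      with bound[of k\<^sub>1] k1 have "b = 0" by simp
      with maximal[of "Suc a" 0] g_le show False by (auto simp: Gamma_iff)
    qed
    \<comment> \<open>\<open>g i\<close> is the least element of \<open>G_set\<close> that is at
      least \<open>a\<close>; it exists because \<open>m\<close> is such an element. The corner with
      this index will dominate \<open>\<mu>\<close>.\<close>
    define i where "i = (LEAST k. k \<le> t \<and> a \<le> g k)"
    have i: "i \<le> t \<and> a \<le> g i"
      unfolding i_def by (rule LeastI[of _ k\<^sub>1]) (use k1 \<open>a \<le> m\<close> in auto)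
    have below_i: "g k < a" if "k < i" for k
      using not_less_Least[of k "\<lambda>k. k \<le> t \<and> a \<le> g k"] that i by (auto simp: i_def)
    have "i \<noteq> 0"
    proof
      assume "i = 0"
      \<comment> \<open>Otherwise \<open>0 = g k\<^sub>0 < a \<le> g 0\<close>, which would put
        \<open>k\<^sub>0\<close> before index 0.\<close>
      with i \<open>a \<noteq> 0\<close> k0 g_less_iff[of k\<^sub>0 0] show False by simp
    qed
    with i have i': "i \<in> {1..t}" by simp
    have le: "g k \<le> g (i - 1)" if "k < i" for k
      using that i' g_less_iff[of "i - 1" k] by (simp add: not_less[symmetric])
    have "(g i, m - g (i - 1), m) \<in> ?\<Gamma>"
      using le g_le[of "i - 1"] i' by (fastforce simp: Gamma_iff g_less_iff)
    moreover have "b \<le> m - g (i - 1)"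
      using bound[of "i - 1"] below_i[of "i - 1"] i' by fastforce
    \<comment> \<open>The corner lies in the set and above \<open>\<mu>\<close>, so maximality
      forces equality.\<close>
    ultimately have "g i = a \<and> m - g (i - 1) = b"
      using i by (intro maximal) auto
    with i' sym[OF i'] show "\<mu> \<in> {(g i, g (t - i + 1), m) | i. i \<in> {1..t}}"
      by (auto simp: \<mu>)
  qed
qed

end
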